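(* Let $r\ge 1$ be an integer and let $z\in\mathbb{C}$ be a complex number which is not a negative integer. Then Vignéras' multiple gamma function $G_r$ satisfies $$G_r(z+1)=\lim_{N\to\infty}\left[\prod_{n=1}^{N}\frac{G_{r-1}(n)}{G_{r-1}(z+n)}\ \prod_{k=0}^{r-1}G_k(N+1)^{\binom{z}{r-k}}\right]$$ and $$G_r(z+1)=\prod_{n=1}^{\infty}\left[\frac{G_{r-1}(n)}{G_{r-1}(z+n)}\prod_{k=0}^{r-1}\left(\frac{G_k(n+1)}{G_k(n)}\right)^{\binom{z}{r-k}}\right].$$
   Context: Vignéras' multiple gamma functions $G_r(z)$, $r\in\mathbb{Z}_{\ge 0}$, are the sequence of meromorphic functions on $\mathbb{C}$ uniquely determined by the following conditions: (i) $G_0(z)=z$; (ii) $G_r(1)=1$; (iii) $G_r(z+1)=G_{r-1}(z)\,G_r(z)$ for $r\ge 1$; (iv) $\frac{d^{r+1}}{dz^{r+1}}\log G_r(z+1)\ge 0$ for real $z\ge 0$. In particular $G_1=\Gamma$ is Euler's gamma function and $G_2$ is Barnes' $G$-function. For $z\in\mathbb{C}$ and an integer $k\ge 0$, $\binom{z}{k}=\frac{z(z-1)\cdots(z-k+1)}{k!}$ (with $\binom{z}{0}=1$). For a positive real number $a$ and $w\in\mathbb{C}$, $a^w=\exp(w\log a)$ with $\log a$ real; the values $G_k(n)$ at positive integers $n$ are positive. The infinite product means the limit of the partial products $\prod_{n=1}^{N}$ as $N\to\infty$. *)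

theory Defs
  imports "HOL-Complex_Analysis.Complex_Analysis"
begin

text \<open>
  The characterising conditions of Vigneras' sequence of multiple gamma functions.

  A meromorphic function on \<open>\<complex>\<close> is represented by a total function that is
  \<^const>\<open>nicely_meromorphic_on\<close>: it is continuous at every point that is not a pole and has the
  dummy value \<open>0\<close> at its poles. The functional equation is an identity between meromorphic
  functions, hence it is required off a closed discrete set (the dummy values at the poles do
  not satisfy it: \<open>\<Gamma>(0 + 1) = 1\<close>, whereas \<open>G\<^sub>0(0) * \<Gamma>(0) = 0\<close>).

  In the last two conditions \<open>log G\<^sub>r(x + 1)\<close> is the real logarithm, so its existence, i.e. the
  positivity of \<open>G\<^sub>r(x + 1)\<close> for real \<open>x \<ge> 0\<close>, is part of the condition. Without it uniqueness
  fails: \<open>\<Gamma>(z) * exp (2 * pi * \<i> * z)\<close> satisfies the remaining conditions for \<open>r = 1\<close>, whichever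
  branch of the logarithm is used.
\<close>

definition vigneras_multiple_gamma :: "(nat \<Rightarrow> complex \<Rightarrow> complex) \<Rightarrow> bool" where
  "vigneras_multiple_gamma G \<longleftrightarrow>
     (\<forall>r. G r nicely_meromorphic_on UNIV) \<and>
     (\<forall>z. G 0 z = z) \<and>
     (\<forall>r. G r 1 = 1) \<and>
     (\<forall>r\<ge>1. \<forall>\<^sub>\<approx>z. G r (z + 1) = G (r - 1) z * G r z) \<and>
     (\<forall>r. \<forall>x::real. x \<ge> 0 \<longrightarrow>
        G r (of_real x + 1) \<in> \<real> \<and> Re (G r (of_real x + 1)) > 0) \<and>
     (\<forall>r. \<forall>x::real. x \<ge> 0 \<longrightarrow>
        (deriv ^^ (r + 1)) (\<lambda>t::real. ln (Re (G r (of_real t + 1)))) x \<ge> 0)"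

end

theory Submission
  imports Defs
begin

text \<open>
  Write \<open>f\<^sub>j(x) = log G\<^sub>j(x + 1)\<close>. The functional equation says that the forward difference of \<open>f\<^bsub>j+1\<^esub>\<close> is
  \<open>f\<^sub>j\<close>, so the polynomial of degree at most \<open>r\<close> that interpolates \<open>f\<^sub>r\<close> at \<open>m, \<dots>, m + r\<close> has at \<open>m + z\<close> the
  value \<open>\<Sum>k\<le>r. (z gchoose (r - k)) f\<^sub>k(m)\<close>. The asserted limit formula states precisely that the
  interpolation error at \<open>m + z\<close> tends to \<open>0\<close> as \<open>m\<close> grows, because the product of the \<open>G\<^bsub>r-1\<^esub>(z + n)\<close> is
  the quotient of \<open>G\<^sub>r(z + N + 1)\<close> and \<open>G\<^sub>r(z + 1)\<close>.

  For real \<open>x\<close> with \<open>0 < x < 1\<close> this is a Bohr-Mollerup argument: since \<open>f\<^sub>r\<^bsup>(r+1)\<^esup> \<ge> 0\<close>, the errors with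
  respect to two neighbouring systems of nodes have opposite signs, and the two interpolation polynomials
  approach each other because the difference of order \<open>r + 1\<close> of \<open>f\<^sub>r\<close> is that of first order of
  \<open>log (x + 1)\<close> (\<open>newton_remainder_bound\<close>, \<open>logG_newton_tendsto\<close>).

  For complex \<open>z\<close> the condition on the real axis gives no direct information, and the error is
  computed instead. Interpolation commutes with differences, so the error of \<open>f\<^bsub>j+1\<^esub>\<close> at \<open>m\<close> is minus the
  sum of the errors of \<open>f\<^sub>j\<close> at \<open>m, m + 1, \<dots>\<close>, provided that it tends to \<open>0\<close>. Starting from the explicit error
  \<open>O(m\<^bsup>-r-1\<^esup>)\<close> of \<open>f\<^sub>0(x) = log (x + 1)\<close> one obtains holomorphic functions \<open>newton_err\<close> of order
  \<open>O(m\<^bsup>-r-1+j\<^esup>)\<close>, defined without reference to \<open>G\<close> (\<open>newton_err_estimates\<close>). By the real case they are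
  the errors of \<open>f\<^sub>j\<close> on \<open>(0, 1)\<close>, and by the identity theorem everywhere (\<open>G_eq_exp_newton\<close>). For \<open>j = r\<close>
  the order is \<open>O(1/m)\<close>, which proves the formula. As a by-product the \<open>G\<^sub>j\<close> vanish at most at
  \<open>0, -1, -2, \<dots>\<close>, so the functional equation holds at every point where it is used.
\<close>

section \<open>Newton interpolation at consecutive integers\<close>

definition fwd_diff :: "(nat \<Rightarrow> 'a::ab_group_add) \<Rightarrow> nat \<Rightarrow> 'a" where
  "fwd_diff u m = u (Suc m) - u m"

text \<open>
  With \<open>u m = f m\<close>, the value \<open>newton_sum r u m z\<close> is the polynomial of degree at most \<open>r\<close> that
  interpolates \<open>f\<close> at \<open>m, m + 1, \<dots>, m + r\<close>, evaluated at \<open>m + z\<close>: the argument is counted from the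
  first node.
\<close>

definition newton_sum :: "nat \<Rightarrow> (nat \<Rightarrow> 'a) \<Rightarrow> nat \<Rightarrow> 'a \<Rightarrow> 'a::field_char_0" where
  "newton_sum r u m z = (\<Sum>k\<le>r. (z gchoose k) * (fwd_diff ^^ k) u m)"

lemma fwd_diff_pow_Suc: "(fwd_diff ^^ Suc k) u = (fwd_diff ^^ k) (fwd_diff u)"
  by (simp only: funpow_Suc_right o_def)

text \<open>
  One difference is peeled off from the outside, whereas the lemma above peels it off from the inside;
  the latter lets a difference operator act on the sequence itself, where it will lower the index of
  a multiple gamma function.
\<close>

lemma fwd_diff_pow_apply:
  "(fwd_diff ^^ Suc k) u m = (fwd_diff ^^ k) u (Suc m) - (fwd_diff ^^ k) u m"
  by (simp add: fwd_diff_def)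

lemma fwd_diff_pow_shift: "(fwd_diff ^^ k) (\<lambda>i. u (n + i)) m = (fwd_diff ^^ k) u (n + m)"
  by (induction k arbitrary: m) (simp_all add: fwd_diff_def)

lemma fwd_diff_pow_diff:
  "(fwd_diff ^^ k) (\<lambda>i. u i - v i) m = (fwd_diff ^^ k) u m - (fwd_diff ^^ k) v m"
  by (induction k arbitrary: m) (simp_all add: fwd_diff_def)

lemma fwd_diff_pow_of_real:
  "(fwd_diff ^^ k) (\<lambda>i. of_real (u i) :: 'a::real_algebra_1) m = of_real ((fwd_diff ^^ k) u m)"
  by (induction k arbitrary: m) (simp_all add: fwd_diff_def)

lemma norm_fwd_diff_pow_le:
  fixes u :: "nat \<Rightarrow> 'a::real_normed_vector"
  assumes "\<And>i. i \<le> k \<Longrightarrow> norm (u (m + i)) \<le> B"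
  shows "norm ((fwd_diff ^^ k) u m) \<le> 2 ^ k * B"
  using assms
proof (induction k arbitrary: m)
  case (Suc k)
  have "norm ((fwd_diff ^^ k) u (Suc m)) \<le> 2 ^ k * B"
    using Suc.prems[of "Suc _"] by (intro Suc.IH) auto
  moreover have "norm ((fwd_diff ^^ k) u m) \<le> 2 ^ k * B"
    using Suc.prems by (intro Suc.IH) auto
  ultimately show ?case
    using norm_triangle_ineq4[of "(fwd_diff ^^ k) u (Suc m)" "(fwd_diff ^^ k) u m"]
    unfolding fwd_diff_pow_apply by simp
qed auto

lemma fwd_diff_pow_tendsto_0:
  fixes u :: "nat \<Rightarrow> 'a::real_normed_vector"
  assumes "u \<longlonglongrightarrow> 0"
  shows "(fwd_diff ^^ k) u \<longlonglongrightarrow> 0"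
proof (induction k)
  case (Suc k)
  from tendsto_diff[OF LIMSEQ_Suc[OF Suc] Suc] show ?case
    by (simp add: fwd_diff_def[abs_def])
qed (use assms in simp)

text \<open>
  Newton interpolation of fixed order commutes with translation of the nodes, hence with the
  difference operator. Since the difference of \<open>log G\<^bsub>r+1\<^esub>\<close> is \<open>log G\<^sub>r\<close>, the interpolation errors of
  all multiple gamma functions are linked by this relation.
\<close>

lemma newton_sum_step_node:
  "newton_sum r u (Suc m) z = newton_sum r u m z + newton_sum r (fwd_diff u) m z"
proof -
  have "(fwd_diff ^^ k) u (Suc m) = (fwd_diff ^^ k) u m + (fwd_diff ^^ k) (fwd_diff u) m" for k
    unfolding fwd_diff_pow_Suc[symmetric] by (simp add: fwd_diff_def)
  thus ?thesis by (simp add: newton_sum_def sum.distrib algebra_simps)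
qed

lemma newton_sum_Suc:
  "newton_sum (Suc r) u m z = newton_sum r u m z + (z gchoose Suc r) * (fwd_diff ^^ Suc r) u m"
  by (simp add: newton_sum_def)

text \<open>
  Pascal's rule for the generalised binomial coefficients.
\<close>

lemma newton_sum_step_arg:
  "newton_sum (Suc r) u m (z + 1) = newton_sum (Suc r) u m z + newton_sum r (fwd_diff u) m z"
proof -
  have "(z + 1 gchoose Suc k) * (fwd_diff ^^ Suc k) u m = (z gchoose Suc k) * (fwd_diff ^^ Suc k) u m
      + (z gchoose k) * (fwd_diff ^^ k) (fwd_diff u) m" for k
    unfolding gbinomial_Suc_Suc fwd_diff_pow_Suc by (simp add: algebra_simps)
  thus ?thesis
    by (simp only: newton_sum_def sum.atMost_Suc_shift sum.distrib) simp
qed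

text \<open>
  The interpolation polynomials for \<open>m + 1, \<dots>, m + 1 + j\<close> and for \<open>m, \<dots>, m + j\<close> agree at the \<open>j\<close>
  common nodes, so at the same point \<open>m + 1 + z\<close> they differ by a multiple of \<open>z gchoose j\<close>, and the
  factor is the difference of order \<open>j + 1\<close>.
\<close>

lemma newton_sum_change_nodes:
  "newton_sum j u (Suc m) z - newton_sum j u m (z + 1) = (z gchoose j) * (fwd_diff ^^ Suc j) u m"
proof (cases j)
  case (Suc i)
  show ?thesis
    unfolding Suc newton_sum_step_node[of "Suc i"] newton_sum_step_arg newton_sum_Suc[of i "fwd_diff u"]
      fwd_diff_pow_Suc by simp
qed (simp add: newton_sum_def fwd_diff_def)

lemma newton_sum_interpolates:
  "i \<le> r \<Longrightarrow> newton_sum r u m (of_nat i) = u (m + i)"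
proof (induction i arbitrary: r u)
  case 0
  have "newton_sum r u m 0 = (\<Sum>k\<in>{0}. (0 gchoose k) * (fwd_diff ^^ k) u m)"
    unfolding newton_sum_def by (rule sum.mono_neutral_right) (auto simp: gbinomial_0_left)
  thus ?case by simp
next
  case (Suc i)
  then obtain r' where [simp]: "r = Suc r'" by (cases r) auto
  have "newton_sum r u m (of_nat i + 1) = newton_sum r u m (of_nat i) + newton_sum r' (fwd_diff u) m (of_nat i)"
    by (simp add: newton_sum_step_arg)
  also have "\<dots> = u (m + i) + fwd_diff u (m + i)"
    using Suc.prems Suc.IH[of r u] Suc.IH[of r' "fwd_diff u"] by auto
  finally show ?case by (simp add: fwd_diff_def add_ac)
qed

lemma newton_sum_diff:
  "newton_sum r (\<lambda>i. u i - v i) m z = newton_sum r u m z - newton_sum r v m z"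
  by (simp add: newton_sum_def fwd_diff_pow_diff algebra_simps sum_subtractf)

lemma newton_sum_shift: "newton_sum r (\<lambda>i. u (n + i)) m z = newton_sum r u (n + m) z"
  by (simp add: newton_sum_def fwd_diff_pow_shift)

lemma of_real_gchoose:
  "of_real (x gchoose k) = (of_real x gchoose k :: 'a::{real_field,field_char_0})"
  by (simp add: gbinomial_prod_rev of_real_prod)

lemma newton_sum_of_real:
  "newton_sum r (\<lambda>i. of_real (u i)) m (of_real x :: 'a::{real_field,field_char_0})
    = of_real (newton_sum r u m x)"
  by (simp add: newton_sum_def fwd_diff_pow_of_real of_real_gchoose)

definition gchoose_poly :: "nat \<Rightarrow> 'a::field_char_0 poly" where
  "gchoose_poly k = Polynomial.smult (1 / fact k) (\<Prod>i<k. [:- of_nat i, 1:])"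

lemma poly_gchoose_poly [simp]: "poly (gchoose_poly k) z = z gchoose k"
  by (simp add: gchoose_poly_def gbinomial_prod_rev poly_prod atLeast0LessThan)

lemma degree_gchoose_poly: "degree (gchoose_poly k :: 'a::field_char_0 poly) = k"
  by (simp add: gchoose_poly_def degree_prod_eq_sum_degree)

lemma coeff_gchoose_poly: "poly.coeff (gchoose_poly k :: 'a::field_char_0 poly) k = 1 / fact k"
proof -
  have "lead_coeff (gchoose_poly k :: 'a poly) = 1 / fact k"
    unfolding gchoose_poly_def lead_coeff_smult lead_coeff_prod by simp
  thus ?thesis by (simp add: degree_gchoose_poly)
qed

definition newton_poly :: "nat \<Rightarrow> (nat \<Rightarrow> 'a) \<Rightarrow> nat \<Rightarrow> 'a::field_char_0 poly" where
  "newton_poly r u m = (\<Sum>k\<le>r. Polynomial.smult ((fwd_diff ^^ k) u m) (gchoose_poly k))"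

lemma poly_newton_poly [simp]: "poly (newton_poly r u m) z = newton_sum r u m z"
  by (simp add: newton_poly_def newton_sum_def poly_sum mult.commute)

lemma degree_newton_poly: "degree (newton_poly r u m) \<le> r"
  unfolding newton_poly_def
  by (intro degree_sum_le) (auto intro!: order.trans[OF degree_smult_le] simp: degree_gchoose_poly)

text \<open>
  Both sides are polynomials of degree at most \<open>r\<close> in \<open>z\<close> that agree at the \<open>r + 1\<close> nodes.
\<close>

lemma newton_sum_poly:
  fixes p :: "'a::field_char_0 poly"
  assumes "degree p \<le> r"
  shows "newton_sum r (\<lambda>i. poly p (of_nat i)) 0 z = poly p z"
proof -
  let ?A = "of_nat ` {..r} :: 'a set"
  have "card ?A = Suc r" by (subst card_image) (auto intro: inj_onI)
  moreover have "poly (newton_poly r (\<lambda>i. poly p (of_nat i)) 0) w = poly p w" if "w \<in> ?A" for w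
    using that by (auto simp: newton_sum_interpolates)
  ultimately have "newton_poly r (\<lambda>i. poly p (of_nat i)) 0 = p"
    using assms degree_newton_poly[of r "\<lambda>i. poly p (of_nat i)" 0]
    by (intro poly_eqI_degree[of ?A]) auto
  thus ?thesis by (metis poly_newton_poly)
qed

section \<open>The sign of the interpolation error on the real line\<close>

text \<open>
  Rolle's theorem between consecutive zeros. The bound \<open>Max S\<close> is what the induction over the largest
  element needs: the zero of \<open>f'\<close> found to the right of the old maximum is then a new one.
\<close>

lemma Rolle_zeros:
  fixes f f' :: "real \<Rightarrow> real"
  assumes "finite S" "S \<noteq> {}" "S \<subseteq> {0<..}"
    and "\<And>t. t > 0 \<Longrightarrow> (f has_real_derivative f' t) (at t)"
    and "\<And>t. t \<in> S \<Longrightarrow> f t = 0"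
  shows "\<exists>T. finite T \<and> T \<subseteq> {0<..Max S} \<and> Suc (card T) = card S \<and> (\<forall>t\<in>T. f' t = 0)"
  using assms(1,2,3,5)
proof (induction S rule: finite_linorder_max_induct)
  case (insert b A)
  show ?case
  proof (cases "A = {}")
    case False
    then obtain T where T: "finite T" "T \<subseteq> {0<..Max A}" "Suc (card T) = card A" "\<forall>t\<in>T. f' t = 0"
      using insert by blast
    have MA: "Max A \<in> A" using False insert by auto
    have lt: "Max A < b" "Max A > 0" using insert MA by auto
    have "\<exists>z>Max A. z < b \<and> f b - f (Max A) = (b - Max A) * f' z"
      using lt by (intro MVT2) (auto intro!: assms)
    moreover have "f b = 0" "f (Max A) = 0" using insert MA by auto
    ultimately obtain \<xi> where \<xi>: "\<xi> > Max A" "\<xi> < b" "f' \<xi> = 0" using lt by auto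
    have Mx: "Max (insert b A) = b" using insert by (intro Max_eqI) (auto intro: less_imp_le)
    have "\<xi> \<notin> T" "b \<notin> A" using T \<xi> insert by auto
    thus ?thesis using T \<xi> lt insert unfolding Mx
      by (intro exI[of _ "insert \<xi> T"]) auto
  qed (auto intro: exI[of _ "{}"])
qed auto

lemma Rolle_iterated:
  fixes F :: "nat \<Rightarrow> real \<Rightarrow> real"
  assumes "finite S" "card S = Suc n" "S \<subseteq> {0<..}"
    and "\<And>k t. t > 0 \<Longrightarrow> (F k has_real_derivative F (Suc k) t) (at t)"
    and "\<And>t. t \<in> S \<Longrightarrow> F 0 t = 0"
  shows "\<exists>t>0. F n t = 0"
  using assms
proof (induction n arbitrary: S F)
  case 0
  then show ?case by (metis One_nat_def card_1_singletonE greaterThan_iff insertCI subsetD)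
next
  case (Suc n)
  have "S \<noteq> {}" using Suc.prems by auto
  from Rolle_zeros[OF Suc.prems(1) this Suc.prems(3) Suc.prems(4)[of _ 0] Suc.prems(5)]
  obtain T where T: "finite T" "T \<subseteq> {0<..Max S}" "Suc (card T) = card S" "\<forall>t\<in>T. F (Suc 0) t = 0"
    by auto
  have "\<exists>t>0. F (Suc n) t = 0"
    using T Suc.prems by (intro Suc.IH[of T "\<lambda>k. F (Suc k)"]) auto
  thus ?case .
qed

text \<open>
  The classical error formula. Let \<open>p\<close> be the interpolation polynomial. If \<open>c\<close> is chosen such that \<open>f - p - c (t - a gchoose j + 1)\<close> vanishes at
  \<open>a + x\<close> besides the \<open>j + 1\<close> nodes, then its derivative of order \<open>j + 1\<close> has a zero, and that derivative is
  \<open>f\<^bsup>(j+1)\<^esup> - c\<close>. So \<open>c\<close> is a value of \<open>f\<^bsup>(j+1)\<^esup>\<close>. The family \<open>F\<close> lists \<open>f\<close> and its derivatives.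
\<close>

lemma newton_remainder_nonneg:
  fixes F :: "nat \<Rightarrow> real \<Rightarrow> real"
  assumes der: "\<And>k t. t > 0 \<Longrightarrow> (F k has_real_derivative F (Suc k) t) (at t)"
    and nonneg: "\<And>t. t > 0 \<Longrightarrow> F (Suc j) t \<ge> 0"
    and "a > 0" "x > 0" and x: "x gchoose Suc j \<noteq> 0"
  shows "\<exists>c\<ge>0. F 0 (real a + x) = newton_sum j (\<lambda>i. F 0 (real i)) a x + c * (x gchoose Suc j)"
proof -
  let ?u = "\<lambda>i. F 0 (real i)"
  define c where "c = (F 0 (real a + x) - newton_sum j ?u a x) / (x gchoose Suc j)"
  define p where "p = newton_poly j ?u a + Polynomial.smult c (gchoose_poly (Suc j))"
  have px: "poly p x = F 0 (real a + x)" using x by (simp add: p_def c_def)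
  have pnode: "poly p (real i) = F 0 (real (a + i))" if "i \<le> j" for i
    using that newton_sum_interpolates[OF that, of ?u a]
    by (simp add: p_def binomial_gbinomial[symmetric])
  have degp: "degree p \<le> Suc j"
    unfolding p_def using degree_newton_poly[of j ?u a]
    by (intro degree_add_le order.trans[OF degree_smult_le]) (auto simp: degree_gchoose_poly)
  have coeffp: "poly.coeff p (Suc j) = c / fact (Suc j)"
    using degree_newton_poly[of j ?u a] unfolding p_def coeff_add coeff_smult coeff_gchoose_poly
    by (simp add: coeff_eq_0)
  have "(pderiv ^^ Suc j) p = [:c:]"
  proof (rule poly_eqI)
    fix n show "poly.coeff ((pderiv ^^ Suc j) p) n = poly.coeff [:c:] n"
      unfolding coeff_higher_pderiv using degp coeffp
      by (cases n) (auto simp: coeff_eq_0 pochhammer_fact[symmetric] simp del: fact_Suc)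
  qed
  define H where "H n t = F n t - poly ((pderiv ^^ n) p) (t - real a)" for n t
  let ?S = "insert (real a + x) ((\<lambda>i. real (a + i)) ` {..j})"
  have "x \<noteq> real i" if "i \<le> j" for i
    using x that by (auto simp: binomial_gbinomial[symmetric] simp del: of_nat_Suc)
  hence "real a + x \<notin> (\<lambda>i. real (a + i)) ` {..j}" by auto
  moreover have "card ((\<lambda>i. real (a + i)) ` {..j}) = Suc j"
    by (subst card_image) (auto intro: inj_onI)
  ultimately have "card ?S = Suc (Suc j)" by simp
  moreover have "(H k has_real_derivative H (Suc k) t) (at t)" if "t > 0" for k t
    unfolding H_def using that by (auto intro!: derivative_eq_intros der)
  moreover have "H 0 t = 0" if "t \<in> ?S" for t
    using that px pnode by (auto simp: H_def)
  ultimately have "\<exists>t>0. H (Suc j) t = 0"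
    using assms by (intro Rolle_iterated[of ?S]) auto
  then obtain t where "t > 0" "F (Suc j) t = c"
    unfolding H_def \<open>(pderiv ^^ Suc j) p = [:c:]\<close> by auto
  hence "c \<ge> 0" using nonneg by force
  moreover have "F 0 (real a + x) = newton_sum j ?u a x + c * (x gchoose Suc j)"
    using x by (simp add: c_def)
  ultimately show ?thesis by blast
qed

text \<open>
  This is the argument of the Bohr-Mollerup theorem in higher order. Between the first two nodes of
  \<open>m + 1, \<dots>, m + 1 + j\<close> the error has the sign of \<open>x gchoose j + 1\<close>; with the nodes \<open>m, \<dots>, m + j\<close> the same
  point has two nodes to its left, and the error has the opposite sign. So \<open>f\<close> lies
  between the two interpolation polynomials, whose distance is known exactly. (Here \<open>j > 0\<close> is
  essential: for \<open>j = 0\<close> both nodes lie on the same side of the point.)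
\<close>

lemma newton_remainder_bound:
  fixes F :: "nat \<Rightarrow> real \<Rightarrow> real"
  assumes der: "\<And>k t. t > 0 \<Longrightarrow> (F k has_real_derivative F (Suc k) t) (at t)"
    and nonneg: "\<And>t. t > 0 \<Longrightarrow> F (Suc j) t \<ge> 0"
    and "m > 0" "0 < x" "x < 1" "j > 0"
  defines "u \<equiv> (\<lambda>i. F 0 (real i))"
  shows "\<bar>F 0 (real (Suc m) + x) - newton_sum j u (Suc m) x\<bar> \<le> \<bar>(x gchoose j) * (fwd_diff ^^ Suc j) u m\<bar>"
proof -
  define \<kappa> where "\<kappa> = x gchoose j"
  have nz: "x gchoose Suc k \<noteq> 0" for k
    using assms by (auto simp: gbinomial_prod_rev)
  have c1: "x gchoose Suc j = (x - j) / real (Suc j) * \<kappa>"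
    using gbinomial_mult_1[of x j] by (simp add: \<kappa>_def field_simps)
  have c2: "x + 1 gchoose Suc j = (x + 1) / real (Suc j) * \<kappa>"
    by (simp add: gbinomial_factors \<kappa>_def)
  have "\<kappa> \<noteq> 0" using nz[of j] c1 by auto
  obtain a where a: "a \<ge> 0" "F 0 (real (Suc m) + x) = newton_sum j u (Suc m) x + a * (x gchoose Suc j)"
    using newton_remainder_nonneg[of F j "Suc m" x] der nonneg assms(4) nz unfolding u_def by blast
  have nz2: "x + 1 gchoose Suc j \<noteq> 0"
    using \<open>\<kappa> \<noteq> 0\<close> \<open>0 < x\<close> unfolding c2 by auto
  have "0 < x + 1" using \<open>0 < x\<close> by simp
  then obtain b where b: "b \<ge> 0" "F 0 (real m + (x + 1)) = newton_sum j u m (x + 1) + b * (x + 1 gchoose Suc j)"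
    using newton_remainder_nonneg[of F j m "x + 1"] der nonneg \<open>m > 0\<close> nz2 unfolding u_def by blast
  define E where "E = F 0 (real (Suc m) + x) - newton_sum j u (Suc m) x"
  define A where "A = a * ((j - x) / real (Suc j))"
  define B where "B = b * ((x + 1) / real (Suc j))"
  have pos: "A \<ge> 0" "B \<ge> 0" using a b assms by (auto simp: A_def B_def)
  \<comment> \<open>the error with respect to the nodes starting at \<open>m + 1\<close>\<close>
  have E1: "E = - A * \<kappa>" using a unfolding E_def c1 A_def by (simp add: field_simps)
  \<comment> \<open>the error with respect to the nodes starting at \<open>m\<close>, seen from those starting at \<open>m + 1\<close>\<close>
  have "real m + (x + 1) = real (Suc m) + x" by simp
  hence E2: "E = B * \<kappa> - \<kappa> * (fwd_diff ^^ Suc j) u m"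
    using b newton_sum_change_nodes[of j u m x] unfolding E_def c2 B_def \<kappa>_def by (simp add: algebra_simps)
  have "(fwd_diff ^^ Suc j) u m = A + B" using E1 E2 \<open>\<kappa> \<noteq> 0\<close>
    by (metis (no_types, opaque_lifting) add.commute diff_eq_eq mult.commute mult_cancel_left mult_minus_left right_diff_distrib add_diff_cancel_left' diff_minus_eq_add)
  hence "\<bar>\<kappa> * (fwd_diff ^^ Suc j) u m\<bar> = \<bar>\<kappa>\<bar> * A + \<bar>\<kappa>\<bar> * B"
    using pos by (simp only: abs_mult) (simp add: distrib_left)
  moreover have "\<bar>E\<bar> = \<bar>\<kappa>\<bar> * A" using pos E1 by (simp add: abs_mult)
  ultimately have "\<bar>E\<bar> \<le> \<bar>\<kappa> * (fwd_diff ^^ Suc j) u m\<bar>" using pos by simp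
  thus ?thesis by (simp add: E_def \<kappa>_def)
qed

section \<open>The error series\<close>

text \<open>
  The term for \<open>i = 0\<close> of the polynomial is \<open>- 1 / 0 = 0\<close>, as it should be.
\<close>

lemma Ln_Taylor_bound:
  fixes x :: complex
  assumes "norm x \<le> 1/2"
  shows "norm (Ln (1 + x) - (\<Sum>i\<le>r. - ((-1) ^ i) / of_nat i * x ^ i)) \<le> 2 * norm x ^ Suc r"
proof -
  define f where "f i = - ((-x) ^ i) / of_nat i" for i :: nat
  have f: "f sums Ln (1 + x)" using Ln_series'[of x] assms unfolding f_def by simp
  have "(\<Sum>i\<le>r. - ((-1) ^ i) / of_nat i * x ^ i) = (\<Sum>i<Suc r. f i)"
    by (simp add: f_def lessThan_Suc_atMost power_minus[of x])
  moreover have "(\<lambda>i. f (i + Suc r)) sums (Ln (1 + x) - (\<Sum>i<Suc r. f i))"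
    using f sums_iff_shift[of f "Suc r"] by simp
  moreover have g: "(\<lambda>i. norm x ^ Suc r * norm x ^ i) sums (norm x ^ Suc r * (1 / (1 - norm x)))"
    using assms by (intro sums_mult geometric_sums) simp
  moreover have "norm (f (i + Suc r)) \<le> norm x ^ Suc r * norm x ^ i" for i
  proof -
    have "norm (f (i + Suc r)) = norm x ^ (i + Suc r) / of_nat (i + Suc r)"
      by (simp only: f_def norm_divide norm_minus_cancel norm_power norm_of_nat)
    also have "\<dots> \<le> norm x ^ (i + Suc r) / 1"
      by (intro divide_left_mono) auto
    finally show ?thesis by (simp add: power_add mult_ac)
  qed
  ultimately have "norm (Ln (1 + x) - (\<Sum>i\<le>r. - ((-1) ^ i) / of_nat i * x ^ i))
      \<le> norm x ^ Suc r * (1 / (1 - norm x))"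
    using norm_suminf_le[of "\<lambda>i. f (i + Suc r)" "\<lambda>i. norm x ^ Suc r * norm x ^ i"]
    by (simp only: sums_iff)
  also have "\<dots> \<le> norm x ^ Suc r * 2"
    using assms by (intro mult_left_mono) (auto simp: field_simps)
  finally show ?thesis by (simp add: mult.commute)
qed

lemma norm_gchoose_le:
  fixes z :: complex
  assumes "norm z \<le> \<rho>"
  shows "norm (z gchoose k) \<le> (\<rho> + real k) ^ k"
proof -
  have "norm (z gchoose k) = (\<Prod>i<k. norm (z - of_nat i)) / fact k"
    by (simp add: gbinomial_prod_rev norm_divide prod_norm[symmetric] atLeast0LessThan)
  also have "\<dots> \<le> (\<Prod>i<k. norm (z - of_nat i)) / 1"
    by (intro divide_left_mono) (auto intro: prod_nonneg simp: fact_ge_1)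
  also have "(\<Prod>i<k. norm (z - of_nat i)) \<le> (\<Prod>i<k. \<rho> + real k)"
    using assms norm_triangle_ineq4[of z "of_nat _"]
    by (intro prod_mono) (auto intro!: order.trans[OF norm_triangle_ineq4] add_mono)
  finally show ?thesis by simp
qed

text \<open>
  Newton interpolation of order \<open>r\<close> is linear and reproduces the Taylor polynomial of order \<open>r\<close>, so the
  interpolation error of \<open>w \<mapsto> Ln (1 + w t)\<close> is that of the Taylor remainder, which is
  of size \<open>t\<^bsup>r+1\<^esup>\<close> at \<open>z\<close> and at all nodes.
\<close>

lemma Ln_newton_remainder_bound:
  fixes z :: complex and t :: real
  assumes "norm z \<le> \<rho>" "real r \<le> \<rho>" "t \<ge> 0" "\<rho> * t \<le> 1/2"
  shows "norm (Ln (1 + z * of_real t) - newton_sum r (\<lambda>i. Ln (1 + of_nat i * of_real t)) 0 z)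
    \<le> (1 + (\<Sum>k\<le>r. (\<rho> + real k) ^ k * 2 ^ k)) * (2 * (\<rho> * t) ^ Suc r)"
proof -
  define p :: "complex poly" where
    "p = (\<Sum>i\<le>r. Polynomial.monom (- ((-1) ^ i) / of_nat i * of_real t ^ i) i)"
  define g where "g w = Ln (1 + w * of_real t) - poly p w" for w :: complex
  define B where "B = 2 * (\<rho> * t) ^ Suc r"
  have "degree p \<le> r"
    unfolding p_def by (intro degree_sum_le) (auto intro: order.trans[OF degree_monom_le])
  have g_bound: "norm (g w) \<le> B" if "norm w \<le> \<rho>" for w
  proof -
    have n: "norm (w * of_real t) \<le> \<rho> * t"
      using that \<open>t \<ge> 0\<close> by (simp add: norm_mult mult_right_mono)
    have "poly p w = (\<Sum>i\<le>r. - ((-1) ^ i) / of_nat i * (w * of_real t) ^ i)"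
      by (simp add: p_def poly_sum poly_monom power_mult_distrib mult_ac)
    hence "norm (g w) \<le> 2 * norm (w * of_real t) ^ Suc r"
      unfolding g_def using Ln_Taylor_bound[of "w * of_real t" r] n assms(4) by auto
    also have "\<dots> \<le> B"
      unfolding B_def by (intro mult_left_mono power_mono n) auto
    finally show ?thesis .
  qed
  have "Ln (1 + z * of_real t) - newton_sum r (\<lambda>i. Ln (1 + of_nat i * of_real t)) 0 z
      = g z - newton_sum r (\<lambda>i. g (of_nat i)) 0 z"
    unfolding g_def newton_sum_diff newton_sum_poly[OF \<open>degree p \<le> r\<close>] by simp
  also have "norm \<dots> \<le> B + (\<Sum>k\<le>r. (\<rho> + real k) ^ k * (2 ^ k * B))"
  proof (rule order.trans[OF norm_triangle_ineq4] add_mono)+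
    show "norm (g z) \<le> B" using assms by (intro g_bound)
    have "norm ((fwd_diff ^^ k) (\<lambda>i. g (of_nat i)) 0) \<le> 2 ^ k * B" if "k \<le> r" for k
      using assms that by (intro norm_fwd_diff_pow_le g_bound) auto
    moreover have "\<rho> \<ge> 0" using assms by linarith
    ultimately show "norm (newton_sum r (\<lambda>i. g (of_nat i)) 0 z) \<le> (\<Sum>k\<le>r. (\<rho> + real k) ^ k * (2 ^ k * B))"
      unfolding newton_sum_def
      by (intro sum_norm_le) (auto simp: norm_mult intro!: mult_mono norm_gchoose_le assms)
  qed
  also have "\<dots> = (1 + (\<Sum>k\<le>r. (\<rho> + real k) ^ k * 2 ^ k)) * B"
    by (simp add: sum_distrib_left sum_distrib_right algebra_simps)
  finally show ?thesis unfolding B_def .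
qed

text \<open>
  \<open>newton_err r j m z\<close> will turn out to be the error, at \<open>m + z\<close>, of the interpolation of order \<open>r\<close> of
  \<open>log G\<^sub>j(x + 1)\<close> with nodes \<open>m, \<dots>, m + r\<close>. For \<open>j = 0\<close> the interpolated function is
  \<open>Ln (m + 1 + w) = Ln (m + 1) + Ln (1 + w / (m + 1))\<close>, of which the constant has no error. The second
  equation is the relation \<open>err (j+1) (m+1) - err (j+1) m = err j m\<close>, summed under the expectation that
  \<open>err (j+1) m\<close> tends to \<open>0\<close>. Defined like this the errors do not refer to any \<open>G\<close>, and are holomorphic
  in \<open>z\<close> by construction.
\<close>

fun newton_err :: "nat \<Rightarrow> nat \<Rightarrow> nat \<Rightarrow> complex \<Rightarrow> complex" where
  "newton_err r 0 m z =
     Ln (1 + z / of_nat (Suc m)) - newton_sum r (\<lambda>i. Ln (1 + of_nat i / of_nat (Suc m))) 0 z"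
| "newton_err r (Suc j) m z = - (\<Sum>n. newton_err r j (m + n) z)"

lemma pochhammer_le_power:
  fixes y :: real
  assumes "y \<ge> 1"
  shows "pochhammer y n \<le> (real n * y) ^ n"
proof -
  have "y + real i \<le> real n * y" if "i < n" for i
  proof -
    have "y + real i \<le> y + real i * y" using assms by (simp add: mult_le_cancel_left1)
    also have "\<dots> = real (Suc i) * y" by (simp add: algebra_simps)
    also have "\<dots> \<le> real n * y" using that assms by (intro mult_right_mono) auto
    finally show ?thesis .
  qed
  hence "(\<Prod>i<n. y + real i) \<le> (\<Prod>i<n. real n * y)"
    using assms by (intro prod_mono) auto
  thus ?thesis by (simp add: pochhammer_prod atLeast0LessThan)
qed

text \<open>
  The series telescopes. Reciprocals of rising factorials are the scale in which the errors are measured,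
  because summation over a tail lowers their order by exactly one.
\<close>

lemma inverse_pochhammer_sums:
  fixes y :: real
  assumes "y > 0" "s > 0"
  shows "(\<lambda>n. real s / pochhammer (y + real n) (Suc s)) sums (1 / pochhammer y s)"
proof -
  define f where "f n = 1 / pochhammer (y + real n) s" for n
  have pos: "pochhammer (y + real n) k > 0" for n k
    using assms by (intro pochhammer_pos) auto
  have "f \<longlonglongrightarrow> 0"
  proof (rule tendsto_sandwich[OF _ _ tendsto_const])
    show "(\<lambda>n. 1 / (y + real n)) \<longlonglongrightarrow> 0" by real_asymp
    have "y + real n \<le> pochhammer (y + real n) s" if "n \<ge> 1" for n
    proof -
      have "(y + real n) * 1 \<le> (y + real n) * pochhammer (y + real n + 1) (s - 1)"
      proof (intro mult_left_mono)
        show "1 \<le> pochhammer (y + real n + 1) (s - 1)"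
          unfolding pochhammer_prod using assms by (intro prod_ge_1) auto
      qed (use assms in auto)
      thus ?thesis using assms pochhammer_rec[of "y + real n" "s - 1"] by simp
    qed
    thus "\<forall>\<^sub>F n in sequentially. f n \<le> 1 / (y + real n)"
      unfolding f_def using assms
      by (intro eventually_sequentiallyI[of 1] divide_left_mono) (auto intro!: mult_pos_pos pos)
    show "\<forall>\<^sub>F n in sequentially. 0 \<le> f n"
      unfolding f_def using pos by (intro always_eventually) (auto intro: less_imp_le)
  qed
  hence "(\<lambda>n. f n - f (Suc n)) sums (f 0 - 0)" by (rule telescope_sums')
  also have "(\<lambda>n. f n - f (Suc n)) = (\<lambda>n. real s / pochhammer (y + real n) (Suc s))"
  proof
    fix n
    define a b where "a = pochhammer (y + real n) s" and "b = pochhammer (y + real n + 1) s"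
    have ab: "a > 0" "b > 0" using pos[of n s] pos[of "Suc n" s] by (auto simp: a_def b_def add_ac)
    have e: "pochhammer (y + real n) (Suc s) = (y + real n) * b"
      "pochhammer (y + real n) (Suc s) = a * (y + real n + real s)"
      unfolding a_def b_def by (rule pochhammer_rec, rule pochhammer_Suc)
    have "f n = (y + real n + real s) / pochhammer (y + real n) (Suc s)"
      unfolding e(2) using ab assms by (simp add: f_def a_def)
    moreover have "f (Suc n) = (y + real n) / pochhammer (y + real n) (Suc s)"
      unfolding e(1) using ab assms by (simp add: f_def b_def add_ac)
    ultimately show "f n - f (Suc n) = real s / pochhammer (y + real n) (Suc s)"
      by (simp add: diff_divide_distrib[symmetric])
  qed
  finally show ?thesis by (simp add: f_def)
qed

text \<open>
  The factor \<open>1 / s \<le> 1\<close> is dropped, so that all errors share one constant.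
\<close>

lemma tail_sum_bound:
  fixes e :: "nat \<Rightarrow> complex"
  assumes "s > 0" and e: "\<And>n. norm (e n) \<le> C / pochhammer (real (Suc (m + n))) (Suc s)"
  shows "summable (\<lambda>n. C / pochhammer (real (Suc (m + n))) (Suc s))"
    and "norm (\<Sum>n. e n) \<le> C / pochhammer (real (Suc m)) s"
proof -
  let ?b = "\<lambda>n. C / pochhammer (real (Suc (m + n))) (Suc s)"
  have "(\<lambda>n. (C / real s) * (real s / pochhammer (real (Suc m) + real n) (Suc s))) sums
     ((C / real s) * (1 / pochhammer (real (Suc m)) s))"
    using assms by (intro sums_mult inverse_pochhammer_sums) auto
  hence sums: "?b sums ((C / real s) * (1 / pochhammer (real (Suc m)) s))"
    using assms by (simp add: add_ac)
  thus "summable ?b" by (rule sums_summable)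
  have "norm (\<Sum>n. e n) \<le> (C / real s) * (1 / pochhammer (real (Suc m)) s)"
    using norm_suminf_le[OF e sums_summable[OF sums]] unfolding sums_unique[OF sums] .
  also have "\<dots> \<le> C * (1 / pochhammer (real (Suc m)) s)"
  proof (intro mult_right_mono)
    have "0 \<le> C / pochhammer (real (Suc (m + 0))) (Suc s)" using e[of 0] norm_ge_zero order_trans by blast
    moreover have "pochhammer (real (Suc (m + 0))) (Suc s) > 0" by (intro pochhammer_pos) simp
    ultimately have "C \<ge> 0" by (simp add: zero_le_divide_iff)
    thus "C / real s \<le> C" using assms by (simp add: divide_le_eq mult_le_cancel_left1)
  qed (auto intro!: less_imp_le pochhammer_pos)
  finally show "norm (\<Sum>n. e n) \<le> C / pochhammer (real (Suc m)) s" by simp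
qed

text \<open>
  For \<open>j = 0\<close> the error is \<open>O(m\<^bsup>-r-1\<^esup>)\<close>, and each of the at most \<open>r\<close> summations costs one order; so
  even for \<open>j = r\<close> one order is left, and the error tends to \<open>0\<close>. This is why the order \<open>r\<close> stays fixed
  while \<open>j\<close> grows.
\<close>

lemma newton_err_bound:
  obtains M C where
    "\<And>j m z. j \<le> r \<Longrightarrow> m \<ge> M \<Longrightarrow> norm z \<le> \<rho> \<Longrightarrow>
       norm (newton_err r j m z) \<le> C / pochhammer (real (Suc m)) (Suc r - j)"
proof -
  define R where "R = max \<rho> (real r)"
  define K where "K = (1 + (\<Sum>k\<le>r. (R + real k) ^ k * 2 ^ k)) * (2 * R ^ Suc r)"
  define C where "C = K * real (Suc r) ^ Suc r"
  \<comment> \<open>guarantees \<open>R / (m + 1) \<le> 1/2\<close>, the range of the Taylor bound\<close>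
  obtain M :: nat where M: "real M \<ge> 2 * R" using real_arch_simple by blast
  have R: "R \<ge> 0" "R \<ge> \<rho>" "R \<ge> real r" by (auto simp: R_def)
  hence "K \<ge> 0" unfolding K_def by (intro mult_nonneg_nonneg add_nonneg_nonneg sum_nonneg) auto
  have "norm (newton_err r j m z) \<le> C / pochhammer (real (Suc m)) (Suc r - j)"
    if "j \<le> r" "m \<ge> M" "norm z \<le> \<rho>" for j m z
    using that
  proof (induction j arbitrary: m)
    case 0
    let ?t = "1 / real (Suc m)"
    have "R * ?t \<le> 1 / 2" using M 0 by (auto simp: field_simps)
    hence "norm (newton_err r 0 m z)
        \<le> (1 + (\<Sum>k\<le>r. (R + real k) ^ k * 2 ^ k)) * (2 * (R * ?t) ^ Suc r)"
      using Ln_newton_remainder_bound[of z R r ?t] 0 R by simp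
    also have "\<dots> = K / real (Suc m) ^ Suc r"
      by (simp only: K_def power_mult_distrib power_divide) (simp add: field_simps)
    also have "\<dots> = C / (real (Suc r) * real (Suc m)) ^ Suc r"
      unfolding C_def power_mult_distrib by (simp del: of_nat_Suc power_Suc)
    also have "\<dots> \<le> C / pochhammer (real (Suc m)) (Suc r)"
      using \<open>K \<ge> 0\<close> pochhammer_le_power[of "real (Suc m)" "Suc r"]
      by (intro divide_left_mono) (auto simp: C_def intro!: mult_pos_pos pochhammer_pos simp del: power_Suc)
    finally show ?case by simp
  next
    case (Suc j)
    have s: "Suc r - j = Suc (Suc r - Suc j)" "Suc r - Suc j > 0" using Suc.prems by auto
    have "norm (\<Sum>n. newton_err r j (m + n) z) \<le> C / pochhammer (real (Suc m)) (Suc r - Suc j)"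
      using Suc.IH Suc.prems s by (intro tail_sum_bound) (auto simp del: of_nat_Suc)
    thus ?case by simp
  qed
  thus thesis by (rule that)
qed

text \<open>
  The bounds are uniform on the disc, so the series converge uniformly and their sums are holomorphic.
\<close>

lemma newton_err_estimates:
  obtains M C where "real M \<ge> \<rho>"
    "\<And>j m z. j \<le> r \<Longrightarrow> m \<ge> M \<Longrightarrow> norm z \<le> \<rho> \<Longrightarrow>
       norm (newton_err r j m z) \<le> C / pochhammer (real (Suc m)) (Suc r - j)"
    "\<And>j m z. Suc j \<le> r \<Longrightarrow> m \<ge> M \<Longrightarrow> norm z \<le> \<rho> \<Longrightarrow>
       (\<lambda>n. newton_err r j (m + n) z) sums (- newton_err r (Suc j) m z)"
    "\<And>j m. j \<le> r \<Longrightarrow> m \<ge> M \<Longrightarrow> newton_err r j m holomorphic_on ball 0 \<rho>"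
proof -
  obtain M0 C where bound: "\<And>j m z. j \<le> r \<Longrightarrow> m \<ge> M0 \<Longrightarrow> norm z \<le> \<rho> \<Longrightarrow>
       norm (newton_err r j m z) \<le> C / pochhammer (real (Suc m)) (Suc r - j)"
    using newton_err_bound by blast
  obtain M1 :: nat where M1: "real M1 \<ge> \<rho>" using real_arch_simple by blast
  define M where "M = max M0 M1"
  have bound': "norm (newton_err r j (m + n) z) \<le> C / pochhammer (real (Suc (m + n))) (Suc (r - j))"
    if "Suc j \<le> r" "m \<ge> M" "norm z \<le> \<rho>" for j m n and z :: complex
    using bound[of j "m + n" z] that by (simp add: M_def Suc_diff_le)
  have summ: "summable (\<lambda>n. C / pochhammer (real (Suc (m + n))) (Suc (r - j)))"
    if "Suc j \<le> r" "m \<ge> M" "norm z \<le> \<rho>" for j m and z :: complex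
    using tail_sum_bound(1)[of "r - j" "\<lambda>n. newton_err r j (m + n) z", OF _ bound'[OF that]] that by simp
  have sums: "(\<lambda>n. newton_err r j (m + n) z) sums (- newton_err r (Suc j) m z)"
    if "Suc j \<le> r" "m \<ge> M" "norm z \<le> \<rho>" for j m and z :: complex
    using summable_sums[OF summable_comparison_test'[OF summ[OF that] bound'[OF that]]] by simp
  have hol: "newton_err r j m holomorphic_on ball 0 \<rho>" if "j \<le> r" "m \<ge> M" for j m
    using that
  proof (induction j arbitrary: m)
    case 0
    have "1 + z / of_nat (Suc m) \<notin> \<real>\<^sub>\<le>\<^sub>0" if "z \<in> ball 0 \<rho>" for z :: complex
    proof -
      have "\<bar>Re z\<bar> < real (Suc m)"
        using that abs_Re_le_cmod[of z] M1 0 by (simp add: M_def)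
      hence "Re (1 + z / of_nat (Suc m)) > 0" by (simp add: field_simps)
      thus ?thesis by (auto simp: complex_nonpos_Reals_iff)
    qed
    hence "(\<lambda>z. newton_err r 0 m z) holomorphic_on ball 0 \<rho>"
      unfolding newton_err.simps newton_sum_def gbinomial_prod_rev
      by (intro holomorphic_intros) auto
    thus ?case by simp
  next
    case (Suc j)
    have "(\<lambda>z. \<Sum>n. newton_err r j (m + n) z) holomorphic_on ball 0 \<rho>"
    proof (rule holomorphic_uniform_sequence)
      show "(\<lambda>z. \<Sum>n<N. newton_err r j (m + n) z) holomorphic_on ball 0 \<rho>" for N
        using Suc by (intro holomorphic_intros) auto
      fix x :: complex assume "x \<in> ball 0 \<rho>"
      then obtain d where d: "d > 0" "cball x d \<subseteq> ball 0 \<rho>"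
        using open_contains_cball_eq[OF open_ball] by blast
      have nx: "norm x \<le> \<rho>" using \<open>x \<in> ball 0 \<rho>\<close> by simp
      have "uniform_limit (cball x d) (\<lambda>N z. \<Sum>n<N. newton_err r j (m + n) z)
          (\<lambda>z. \<Sum>n. newton_err r j (m + n) z) sequentially"
        using d Suc.prems
        by (intro Weierstrass_m_test[OF bound' summ[OF _ _ nx]]) (auto simp: subset_iff less_imp_le)
      with d show "\<exists>d>0. cball x d \<subseteq> ball 0 \<rho> \<and> uniform_limit (cball x d)
          (\<lambda>N z. \<Sum>n<N. newton_err r j (m + n) z) (\<lambda>z. \<Sum>n. newton_err r j (m + n) z) sequentially"
        by blast
    qed auto
    hence "(\<lambda>z. newton_err r (Suc j) m z) holomorphic_on ball 0 \<rho>"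
      unfolding newton_err.simps by (intro holomorphic_intros)
    thus ?case by simp
  qed
  show thesis by (rule that[of M C]) (use bound sums hol M1 in \<open>auto simp: M_def\<close>)
qed

section \<open>An identity theorem\<close>

text \<open>
  The quotient \<open>f / g\<close> is again nicely meromorphic, and a nicely meromorphic function that takes the
  value \<open>1\<close> frequently is constant. It follows that \<open>f\<close> has no poles and no zeros in \<open>A\<close>.
\<close>

lemma nicely_meromorphic_eq_holomorphic:
  assumes f: "f nicely_meromorphic_on A" and g: "g holomorphic_on A" "\<And>z. z \<in> A \<Longrightarrow> g z \<noteq> 0"
    and A: "open A" "connected A" "p \<in> A"
    and freq: "frequently (\<lambda>z. f z = g z) (at p)" and w: "w \<in> A"
  shows "f w = g w"
proof -
  have an: "(\<lambda>z. inverse (g z)) analytic_on A"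
    using g A by (subst analytic_on_open) (auto intro: holomorphic_intros)
  have "(\<lambda>z. f z * inverse (g z)) nicely_meromorphic_on A"
    unfolding nicely_meromorphic_on_def
  proof (intro conjI ballI)
    show "(\<lambda>z. f z * inverse (g z)) meromorphic_on A"
      using f unfolding nicely_meromorphic_on_def
      by (intro meromorphic_on_mult analytic_on_imp_meromorphic_on[OF an]) auto
    fix z assume z: "z \<in> A"
    have an': "(\<lambda>z. inverse (g z)) analytic_on {z}" using an z by (auto intro: analytic_on_subset)
    consider "is_pole f z" "f z = 0" | "f \<midarrow>z\<rightarrow> f z"
      using f z unfolding nicely_meromorphic_on_def by blast
    thus "is_pole (\<lambda>z. f z * inverse (g z)) z \<and> f z * inverse (g z) = 0 \<or>
        (\<lambda>z. f z * inverse (g z)) \<midarrow>z\<rightarrow> f z * inverse (g z)"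
    proof cases
      case 1
      thus ?thesis using is_pole_mult_analytic_nonzero2[OF 1(1) an'] g z by simp
    next
      case 2
      have "(\<lambda>z. inverse (g z)) \<midarrow>z\<rightarrow> inverse (g z)"
        using analytic_at_imp_isCont[OF an'] by (simp add: isCont_def)
      with 2 show ?thesis by (intro disjI2 tendsto_mult)
    qed
  qed
  note nice = this
  have "eventually (\<lambda>z. z \<in> A) (at p)"
    using A by (intro eventually_at_in_open') auto
  from frequently_eventually_frequently[OF freq this]
  have "frequently (\<lambda>z. f z * inverse (g z) = 1) (at p)"
    by (rule frequently_elim1) (use g in auto)
  from frequently_eq_meromorphic_imp_constant[OF this nice A w]
  have "f w * inverse (g w) = 1" .
  thus ?thesis using g w by (simp add: field_simps)
qed

section \<open>Multiple gamma functions on the positive real axis\<close>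

locale multiple_gamma =
  fixes G :: "nat \<Rightarrow> complex \<Rightarrow> complex"
  assumes vigneras: "vigneras_multiple_gamma G"
begin

text \<open>
  The argument is shifted by one, as in the convexity condition: \<open>logG r m = log G\<^sub>r(m + 1)\<close>.
\<close>

definition logG :: "nat \<Rightarrow> real \<Rightarrow> real" where
  "logG r x = ln (Re (G r (of_real x + 1)))"

lemma nice: "G r nicely_meromorphic_on UNIV"
  and G_0: "G 0 z = z" and G_at_1: "G r 1 = 1"
  using vigneras unfolding vigneras_multiple_gamma_def by blast+

lemma logG_deriv_nonneg: "x \<ge> 0 \<Longrightarrow> (deriv ^^ Suc r) (logG r) x \<ge> 0"
  using vigneras unfolding vigneras_multiple_gamma_def logG_def[abs_def] by simp

lemma G_eq_exp_logG:
  assumes "x \<ge> 0"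
  shows "G r (of_real x + 1) = of_real (exp (logG r x))"
proof -
  have "G r (of_real x + 1) \<in> \<real>" "Re (G r (of_real x + 1)) > 0"
    using vigneras assms by (auto simp: vigneras_multiple_gamma_def)
  thus ?thesis by (auto simp: logG_def elim: Reals_cases)
qed

lemma G_nonzero_real: "x \<ge> 0 \<Longrightarrow> G r (of_real x + 1) \<noteq> 0"
  by (simp add: G_eq_exp_logG)

text \<open>
  A nicely meromorphic function is \<open>0\<close> at its poles, so a nonzero value rules out a pole.
\<close>

lemma analytic_at_nonzero:
  assumes "G r z \<noteq> 0"
  shows "G r analytic_on {z}"
proof (rule nicely_meromorphic_on_imp_analytic_at[OF nice])
  show "\<not> is_pole (G r) z"
    using assms nice[of r] is_pole_tendsto[of "G r" z]
      not_tendsto_and_filterlim_at_infinity[of "at z" "G r" "G r z"]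
    unfolding nicely_meromorphic_on_def is_pole_def by auto
qed auto

text \<open>
  The functional equation is known off a sparse set only. At a point \<open>z\<close> where two of the three values are
  nonzero it shows that \<open>G\<^bsub>r+1\<^esub>\<close> has a finite limit at \<open>z\<close>, hence no pole, and it extends by continuity.
\<close>

lemma functional_equation:
  assumes "G (Suc r) (z + 1) \<noteq> 0" "G r z \<noteq> 0"
  shows "G (Suc r) (z + 1) = G r z * G (Suc r) z"
proof -
  have cont: "isCont (G (Suc r)) (z + 1)" "isCont (G r) z"
    using assms by (auto intro: analytic_at_imp_isCont analytic_at_nonzero)
  have shift: "((\<lambda>w. w + 1) \<longlongrightarrow> z + 1) (at z)" by (intro tendsto_intros)
  have lim: "((\<lambda>w. G (Suc r) (w + 1) / G r w) \<longlongrightarrow> G (Suc r) (z + 1) / G r z) (at z)"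
    using cont assms by (intro tendsto_divide isCont_tendsto_compose[OF cont(1) shift]) (auto simp: isCont_def)
  have "\<forall>\<^sub>F w in at z. G (Suc r) (w + 1) = G r w * G (Suc r) w"
    using vigneras unfolding vigneras_multiple_gamma_def
    by (intro eventually_cosparse_imp_eventually_at[of _ UNIV]) (auto dest: spec[of _ "Suc r"])
  moreover have "\<forall>\<^sub>F w in at z. G r w \<noteq> 0"
    using cont(2) assms(2) unfolding isCont_def by (rule tendsto_imp_eventually_ne)
  ultimately have ev: "\<forall>\<^sub>F w in at z. G (Suc r) (w + 1) / G r w = G (Suc r) w"
    by eventually_elim auto
  have lim': "G (Suc r) \<midarrow>z\<rightarrow> G (Suc r) (z + 1) / G r z"
    using lim tendsto_cong[OF ev] by simp
  hence "\<not> is_pole (G (Suc r)) z"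
    using not_tendsto_and_filterlim_at_infinity[OF at_neq_bot] unfolding is_pole_def by blast
  hence "G (Suc r) \<midarrow>z\<rightarrow> G (Suc r) z"
    using nice[of "Suc r"] unfolding nicely_meromorphic_on_def by auto
  hence "G (Suc r) z = G (Suc r) (z + 1) / G r z"
    using lim' by (intro tendsto_unique[OF at_neq_bot])
  thus ?thesis using assms by simp
qed

lemma logG_step:
  assumes "x \<ge> 0"
  shows "logG (Suc r) (x + 1) = logG r x + logG (Suc r) x"
proof -
  have "complex_of_real (exp (logG (Suc r) (x + 1))) = of_real (exp (logG r x) * exp (logG (Suc r) x))"
    using functional_equation[of r "of_real x + 1"] assms
      G_nonzero_real[of "x + 1" "Suc r"] G_nonzero_real[of x r]
      G_eq_exp_logG[of "x + 1" "Suc r"] by (simp add: G_eq_exp_logG)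
  hence "exp (logG (Suc r) (x + 1)) = exp (logG r x) * exp (logG (Suc r) x)"
    using of_real_eq_iff by blast
  thus ?thesis by (simp add: exp_add[symmetric])
qed

lemma logG_0: "x \<ge> 0 \<Longrightarrow> logG 0 x = ln (x + 1)"
  by (simp add: logG_def G_0)

lemma fwd_diff_logG: "(fwd_diff ^^ k) (\<lambda>i. logG (j + k) (real i)) = (\<lambda>i. logG j (real i))"
proof (induction k)
  case (Suc k)
  have "fwd_diff (\<lambda>i. logG (j + Suc k) (real i)) = (\<lambda>i. logG (j + k) (real i))"
    using logG_step[of "real _" "j + k"] by (auto simp: fwd_diff_def add_ac)
  thus ?case unfolding fwd_diff_pow_Suc using Suc by simp
qed auto

text \<open>
  After \<open>j\<close> differences \<open>log G\<^sub>j(x + 1)\<close> has become \<open>log (x + 1)\<close>, and there is at least one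
  further difference.
\<close>

lemma fwd_diff_logG_tendsto_0:
  assumes "j \<le> r"
  shows "(fwd_diff ^^ Suc r) (\<lambda>i. logG j (real i)) \<longlonglongrightarrow> 0"
proof -
  have "(\<lambda>m. ln (real (Suc m) + 1) - ln (real m + 1)) \<longlonglongrightarrow> 0" by real_asymp
  hence "fwd_diff (\<lambda>i. logG 0 (real i)) \<longlonglongrightarrow> 0"
    by (simp add: fwd_diff_def[abs_def] logG_0 add_ac)
  moreover have "(fwd_diff ^^ Suc r) (\<lambda>i. logG j (real i))
      = (fwd_diff ^^ (r - j)) (fwd_diff (\<lambda>i. logG 0 (real i)))"
  proof -
    have "(fwd_diff ^^ Suc r) (\<lambda>i. logG j (real i)) = (fwd_diff ^^ ((r - j) + Suc j)) (\<lambda>i. logG j (real i))"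
      using assms by simp
    also have "\<dots> = (fwd_diff ^^ (r - j)) (fwd_diff ((fwd_diff ^^ j) (\<lambda>i. logG j (real i))))"
      by (simp only: funpow_add funpow.simps o_def)
    finally show ?thesis using fwd_diff_logG[of j 0] by simp
  qed
  ultimately show ?thesis by (simp only: fwd_diff_pow_tendsto_0)
qed

text \<open>
  On the positive reals \<open>logG r\<close> is the restriction of a holomorphic function, so its iterated
  real derivatives, which \<^const>\<open>deriv\<close> merely denotes, do exist.
\<close>

lemma logG_has_derivative:
  assumes "t > 0"
  shows "((deriv ^^ n) (logG r) has_real_derivative (deriv ^^ Suc n) (logG r) t) (at t)"
proof -
  define g where "g w = Ln (G r (w + 1))" for w
  have g: "g analytic_on {of_real t}" if "t > 0" for t :: real
  proof -
    have "G r analytic_on {of_real t + 1}"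
      using that by (intro analytic_at_nonzero G_nonzero_real) simp
    hence "(\<lambda>w. G r (w + 1)) analytic_on {of_real t}"
      by (intro analytic_on_compose_gen[of "\<lambda>w. w + 1" _ "G r", unfolded o_def])
         (auto intro!: analytic_intros)
    thus ?thesis unfolding g_def using that
      by (intro analytic_intros) (auto simp: G_eq_exp_logG)
  qed
  have der: "((\<lambda>t. Re ((deriv ^^ n) g (of_real t))) has_real_derivative
      Re ((deriv ^^ Suc n) g (of_real t))) (at t)" if "t > 0" for n and t :: real
  proof -
    have "((deriv ^^ n) g has_field_derivative (deriv ^^ Suc n) g (of_real t)) (at (of_real t))"
      using g[OF that] by (auto intro!: analytic_derivI analytic_higher_deriv)
    thus ?thesis by (intro has_field_derivative_Re has_vector_derivative_real_field)
  qed
  have eq: "(deriv ^^ n) (logG r) t = Re ((deriv ^^ n) g (of_real t)) \<and>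
      ((deriv ^^ n) (logG r) has_real_derivative Re ((deriv ^^ Suc n) g (of_real t))) (at t)"
    if "t > 0" for n t
    using that
  proof (induction n arbitrary: t)
    case 0
    have *: "logG r t = Re (g (of_real t))" if "t > 0" for t
      using that by (simp add: g_def G_eq_exp_logG Ln_of_real)
    have "(logG r has_real_derivative Re ((deriv ^^ Suc 0) g (of_real t))) (at t)"
      by (rule has_field_derivative_transform_within_open[OF der[of t 0], of "{0<..}"])
         (use 0 * in auto)
    with * 0 show ?case by simp
  next
    case (Suc n)
    have *: "(deriv ^^ Suc n) (logG r) t = Re ((deriv ^^ Suc n) g (of_real t))" if "t > 0" for t
      using Suc.IH[OF that] DERIV_imp_deriv by auto
    have "((deriv ^^ Suc n) (logG r) has_real_derivative Re ((deriv ^^ Suc (Suc n)) g (of_real t))) (at t)"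
      by (rule has_field_derivative_transform_within_open[OF der[of t "Suc n"], of "{0<..}"])
         (use Suc.prems * in auto)
    with * Suc.prems show ?case by blast
  qed
  show ?thesis using eq[OF assms, of n] eq[OF assms, of "Suc n"] by simp
qed

text \<open>
  The only place where the convexity condition enters. For \<open>r = j\<close> the error is squeezed by
  \<open>newton_remainder_bound\<close>, and the additional terms for larger \<open>r\<close> tend to \<open>0\<close>.
\<close>

lemma logG_newton_tendsto:
  assumes "0 < x" "x < 1" "0 < j" "j \<le> r"
  shows "(\<lambda>m. logG j (real m + x) - newton_sum r (\<lambda>i. logG j (real i)) m x) \<longlonglongrightarrow> 0"
  using \<open>j \<le> r\<close>
proof (induction r rule: nat_induct_at_least)
  case base
  let ?u = "\<lambda>i. logG j (real i)"
  have "(\<lambda>m. logG j (real (Suc m) + x) - newton_sum j ?u (Suc m) x) \<longlonglongrightarrow> 0"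
  proof (rule Lim_null_comparison)
    show "\<forall>\<^sub>F m in sequentially. norm (logG j (real (Suc m) + x) - newton_sum j ?u (Suc m) x)
        \<le> \<bar>(x gchoose j) * (fwd_diff ^^ Suc j) ?u m\<bar>"
      using newton_remainder_bound[of "\<lambda>n. (deriv ^^ n) (logG j)" j _ x]
        logG_has_derivative logG_deriv_nonneg assms
      by (intro eventually_sequentiallyI[of 1]) (auto simp del: funpow.simps of_nat_Suc)
    show "(\<lambda>m. \<bar>(x gchoose j) * (fwd_diff ^^ Suc j) ?u m\<bar>) \<longlonglongrightarrow> 0"
      by (intro tendsto_rabs_zero tendsto_mult_right_zero fwd_diff_logG_tendsto_0) simp
  qed
  thus ?case by (rule LIMSEQ_imp_Suc)
next
  case (Suc r)
  have "(\<lambda>m. (x gchoose Suc r) * (fwd_diff ^^ Suc r) (\<lambda>i. logG j (real i)) m) \<longlonglongrightarrow> 0"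
    using Suc.hyps by (intro tendsto_mult_right_zero fwd_diff_logG_tendsto_0)
  from tendsto_diff[OF Suc.IH this] show ?case
    unfolding newton_sum_Suc by (simp add: algebra_simps)
qed

section \<open>The Newton expansion in the complex plane\<close>

abbreviation newton_logG :: "nat \<Rightarrow> nat \<Rightarrow> nat \<Rightarrow> complex \<Rightarrow> complex" where
  "newton_logG r j m z \<equiv> newton_sum r (\<lambda>i. of_real (logG j (real i))) m z"

lemma G_0_eq_exp_newton:
  assumes "norm z < real (Suc m)"
  shows "G 0 (of_nat (Suc m) + z) = exp (newton_logG r 0 m z + newton_err r 0 m z)"
proof -
  let ?u = "\<lambda>i. complex_of_real (logG 0 (real i))"
  let ?v = "\<lambda>i. Ln (1 + of_nat i / of_nat (Suc m)) :: complex"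
  have v: "?v i = of_real (ln (1 + real i / real (Suc m)))" for i
    using Ln_of_real[of "1 + real i / real (Suc m)"] by (simp add: add_pos_nonneg)
  have u: "?u (m + i) - ?v i = poly [:?u m:] (of_nat i)" for i
  proof -
    have "real (m + i) + 1 = real (Suc m) * (1 + real i / real (Suc m))" by (simp add: field_simps)
    hence "ln (real (m + i) + 1) = ln (real (Suc m)) + ln (1 + real i / real (Suc m))"
      by (simp only:) (subst ln_mult, auto simp: add_pos_nonneg)
    thus ?thesis unfolding v by (simp add: logG_0 add_ac)
  qed
  have "newton_logG r 0 m z + newton_err r 0 m z
     = newton_sum r (\<lambda>i. ?u (m + i) - ?v i) 0 z + Ln (1 + z / of_nat (Suc m))"
    using newton_sum_shift[of r ?u m 0 z] unfolding newton_sum_diff by simp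
  also have "\<dots> = ?u m + Ln (1 + z / of_nat (Suc m))"
    unfolding u by (subst newton_sum_poly) auto
  finally have *: "newton_logG r 0 m z + newton_err r 0 m z = ?u m + Ln (1 + z / of_nat (Suc m))" .
  have "norm (- of_nat (Suc m) :: complex) = real (Suc m)"
    unfolding norm_minus_cancel norm_of_nat ..
  hence "z \<noteq> - of_nat (Suc m)" using assms by auto
  hence "1 + z / of_nat (Suc m) \<noteq> 0"
    by (simp add: divide_eq_eq add_eq_0_iff del: of_nat_Suc)
  hence "exp (?u m + Ln (1 + z / of_nat (Suc m))) = of_nat (Suc m) * (1 + z / of_nat (Suc m))"
    by (simp add: exp_add logG_0 exp_of_real add_ac del: of_nat_Suc) (simp add: add_ac)
  also have "\<dots> = of_nat (Suc m) + z" by (simp add: field_simps del: of_nat_Suc)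
  finally show ?thesis unfolding * G_0 by simp
qed

text \<open>
  Let \<open>W n\<close> be the interpolation error of \<open>log G\<^bsub>j+1\<^esub>\<close> at \<open>n + x\<close>. Its increments are the errors for \<open>j\<close>,
  and \<open>W n\<close> tends to \<open>0\<close>; therefore \<open>W m\<close> is minus the sum of the increments from \<open>m\<close> on, which is
  \<open>newton_err\<close>. The comparison is made between exponentials, because the hypothesis on \<open>G j\<close>
  determines its logarithm only modulo \<open>2 \<pi> \<i>\<close>.
\<close>

lemma G_eq_exp_newton_real:
  assumes x: "0 < x" "x < 1" and j: "Suc j \<le> r"
    and IH: "\<And>n. n \<ge> m \<Longrightarrow>
      G j (of_nat (Suc n) + of_real x) = exp (newton_logG r j n (of_real x) + newton_err r j n (of_real x))"
    and sums: "(\<lambda>n. newton_err r j (m + n) (of_real x)) sums (- newton_err r (Suc j) m (of_real x))"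
  shows "G (Suc j) (of_nat (Suc m) + of_real x)
    = exp (newton_logG r (Suc j) m (of_real x) + newton_err r (Suc j) m (of_real x))"
proof -
  define W where "W n = logG (Suc j) (real n + x) - newton_sum r (\<lambda>i. logG (Suc j) (real i)) n x" for n
  have G_exp: "G i (of_nat (Suc n) + of_real x) = exp (of_real (logG i (real n + x)))" for i n
    using G_eq_exp_logG[of "real n + x" i] x by (simp add: add_ac exp_of_real)
  have diff: "W (Suc n) - W n = logG j (real n + x) - newton_sum r (\<lambda>i. logG j (real i)) n x" for n
  proof -
    have "fwd_diff (\<lambda>i. logG (Suc j) (real i)) = (\<lambda>i. logG j (real i))"
      using fwd_diff_logG[of 1 j] by simp
    thus ?thesis unfolding W_def newton_sum_step_node
      using logG_step[of "real n + x" j] x by (simp add: add_ac)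
  qed
  have step: "exp (complex_of_real (W (Suc n) - W n)) = exp (newton_err r j n (of_real x))" if "n \<ge> m" for n
    using IH[OF that] unfolding G_exp diff newton_sum_of_real by (simp add: exp_add exp_diff)
  have "exp (complex_of_real (W (m + n) - W m)) = exp (\<Sum>i<n. newton_err r j (m + i) (of_real x))" for n
  proof (induction n)
    case (Suc n)
    have "exp (complex_of_real (W (m + Suc n) - W m))
      = exp (complex_of_real (W (Suc (m + n)) - W (m + n))) * exp (complex_of_real (W (m + n) - W m))"
      by (simp add: exp_add[symmetric])
    also have "\<dots> = exp (\<Sum>i<Suc n. newton_err r j (m + i) (of_real x))"
      unfolding Suc step[OF le_add1] by (simp add: exp_add)
    finally show ?case .
  qed simp
  moreover have "W \<longlonglongrightarrow> 0"
    unfolding W_def using x j by (intro logG_newton_tendsto) auto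
  hence "(\<lambda>n. W (m + n)) \<longlonglongrightarrow> 0"
    using LIMSEQ_ignore_initial_segment[of W 0 m] by (simp add: add.commute)
  hence "(\<lambda>n. exp (complex_of_real (W (m + n) - W m))) \<longlonglongrightarrow> exp (complex_of_real (0 - W m))"
    by (intro tendsto_intros)
  moreover have "(\<lambda>n. exp (\<Sum>i<n. newton_err r j (m + i) (of_real x)))
      \<longlonglongrightarrow> exp (- newton_err r (Suc j) m (of_real x))"
    using sums unfolding sums_def by (intro tendsto_exp)
  ultimately have "exp (complex_of_real (0 - W m)) = exp (- newton_err r (Suc j) m (of_real x))"
    using LIMSEQ_unique by auto
  hence "exp (complex_of_real (W m)) = exp (newton_err r (Suc j) m (of_real x))"
    by (simp only: diff_0 of_real_minus exp_minus inverse_eq_iff_eq)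
  hence "exp (newton_logG r (Suc j) m (of_real x) + newton_err r (Suc j) m (of_real x))
      = exp (newton_logG r (Suc j) m (of_real x) + of_real (W m))"
    by (simp only: exp_add)
  also have "newton_logG r (Suc j) m (of_real x) + of_real (W m) = of_real (logG (Suc j) (real m + x))"
    unfolding newton_sum_of_real W_def by simp
  finally show ?thesis unfolding G_exp by simp
qed

text \<open>
  On real points the expansion has been proved, and both sides are meromorphic in a disc around \<open>m + 1\<close>
  that contains a real interval; so it holds in the whole disc. Large \<open>m\<close> allow discs of any size.
\<close>

lemma G_eq_exp_newton:
  obtains e where "e \<longlonglongrightarrow> 0"
    "\<forall>\<^sub>F m in sequentially. G r (of_nat (Suc m) + z) = exp (newton_logG r r m z + e m)"
proof -
  \<comment> \<open>the disc of radius \<open>\<rho>\<close> must contain \<open>z\<close> and the real interval \<open>(0, 1)\<close>\<close>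
  define \<rho> where "\<rho> = norm z + 2"
  obtain M C where M: "real M \<ge> \<rho>"
    and bound: "\<And>j m z. j \<le> r \<Longrightarrow> m \<ge> M \<Longrightarrow> norm z \<le> \<rho> \<Longrightarrow>
       norm (newton_err r j m z) \<le> C / pochhammer (real (Suc m)) (Suc r - j)"
    and sums: "\<And>j m z. Suc j \<le> r \<Longrightarrow> m \<ge> M \<Longrightarrow> norm z \<le> \<rho> \<Longrightarrow>
       (\<lambda>n. newton_err r j (m + n) z) sums (- newton_err r (Suc j) m z)"
    and hol: "\<And>j m. j \<le> r \<Longrightarrow> m \<ge> M \<Longrightarrow> newton_err r j m holomorphic_on ball 0 \<rho>"
    using newton_err_estimates[of \<rho> r] by metis
  have "\<rho> \<ge> 2" by (simp add: \<rho>_def)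
  have main: "G j (of_nat (Suc m) + w) = exp (newton_logG r j m w + newton_err r j m w)"
    if "j \<le> r" "m \<ge> M" "norm w < \<rho>" for j m w
    using that
  proof (induction j arbitrary: m w)
    case 0
    thus ?case using M by (intro G_0_eq_exp_newton) auto
  next
    case (Suc j)
    let ?c = "of_nat (Suc m) :: complex"
    let ?g = "\<lambda>w. exp (newton_logG r (Suc j) m (w - ?c) + newton_err r (Suc j) m (w - ?c))"
    have real: "G (Suc j) (?c + of_real x) = ?g (?c + of_real x)" if "0 < x" "x < 1" for x
      unfolding add_diff_cancel_left' using that Suc.prems \<open>\<rho> \<ge> 2\<close>
      by (intro G_eq_exp_newton_real Suc.IH sums) auto
    have "G (Suc j) (?c + w) = ?g (?c + w)"
    proof (rule nicely_meromorphic_eq_holomorphic[where f = "G (Suc j)" and g = ?g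
        and A = "ball ?c \<rho>" and p = "?c + of_real (1/2)"])
      show "G (Suc j) nicely_meromorphic_on ball ?c \<rho>"
        using nice by (rule nicely_meromorphic_on_subset) auto
      have "newton_err r (Suc j) m \<circ> (\<lambda>w. w - ?c) holomorphic_on ball ?c \<rho>"
        using hol[OF Suc.prems(1,2)]
        by (rule holomorphic_on_compose_gen[rotated]) (auto intro!: holomorphic_intros simp: dist_norm norm_minus_commute)
      thus "?g holomorphic_on ball ?c \<rho>"
        unfolding o_def newton_sum_def gbinomial_prod_rev by (intro holomorphic_intros) auto
      show "?c + of_real (1/2) \<in> ball ?c \<rho>" using \<open>\<rho> \<ge> 2\<close> by (simp add: dist_norm)
      show "\<exists>\<^sub>F w in at (?c + of_real (1/2)). G (Suc j) w = ?g w"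
        unfolding frequently_at
      proof (intro allI impI)
        fix d :: real assume "d > 0"
        define x where "x = 1/2 + min (d/2) (1/4)"
        have x: "0 < x" "x < 1" "x \<noteq> 1/2" "\<bar>x - 1/2\<bar> < d" using \<open>d > 0\<close> by (auto simp: x_def)
        have "dist (?c + of_real x) (?c + of_real (1/2)) < d"
          unfolding dist_add_cancel using x by (simp only: dist_of_real dist_real_def)
        moreover have "?c + of_real x \<noteq> ?c + of_real (1/2)"
          unfolding add_left_cancel of_real_eq_iff using x by simp
        ultimately show "\<exists>w\<in>UNIV. w \<noteq> ?c + of_real (1/2) \<and> dist w (?c + of_real (1/2)) < d \<and> G (Suc j) w = ?g w"
          using real[OF x(1,2)] by blast
      qed
      show "?c + w \<in> ball ?c \<rho>" using Suc.prems by (simp add: dist_norm)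
    qed auto
    thus ?case unfolding add_diff_cancel_left' .
  qed
  show thesis
  proof (rule that)
    show "(\<lambda>m. newton_err r r m z) \<longlonglongrightarrow> 0"
    proof (rule Lim_null_comparison)
      show "\<forall>\<^sub>F m in sequentially. norm (newton_err r r m z) \<le> C / real (Suc m)"
        using bound[of r _ z] by (intro eventually_sequentiallyI[of M]) (simp add: \<rho>_def)
      show "(\<lambda>m. C / real (Suc m)) \<longlonglongrightarrow> 0" by real_asymp
    qed
    show "\<forall>\<^sub>F m in sequentially. G r (of_nat (Suc m) + z) = exp (newton_logG r r m z + newton_err r r m z)"
      using main[of r _ z] by (intro eventually_sequentiallyI[of M]) (simp add: \<rho>_def)
  qed
qed

text \<open>
  Far to the right \<open>G\<^sub>r\<close> is an exponential, hence nonzero. The functional equation carries this back to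
  \<open>z\<close> step by step as long as \<open>G\<^bsub>r-1\<^esub>\<close> does not vanish on the way.
\<close>

lemma G_nonzero:
  assumes "\<And>n. z \<noteq> - of_nat n"
  shows "G r z \<noteq> 0"
  using assms
proof (induction r arbitrary: z)
  case 0
  show ?case using 0[of 0] by (simp add: G_0)
next
  case (Suc r)
  note IH = Suc.IH
  have down: "G (Suc r) w \<noteq> 0"
    if "\<And>n. w \<noteq> - of_nat n" "G (Suc r) (w + of_nat n) \<noteq> 0" for n w
    using that
  proof (induction n arbitrary: w)
    case (Suc n)
    have "w + 1 \<noteq> - of_nat k" for k
    proof
      assume "w + 1 = - of_nat k"
      hence "(w + 1) - 1 = - of_nat (Suc k)" by simp
      thus False using Suc.prems(1)[of "Suc k"] by simp
    qed
    moreover have "G (Suc r) ((w + 1) + of_nat n) \<noteq> 0" using Suc.prems(2) by (simp add: add_ac)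
    ultimately have "G (Suc r) (w + 1) \<noteq> 0" by (rule Suc.IH)
    moreover have "G r w \<noteq> 0" by (rule IH) (rule Suc.prems(1))
    ultimately show ?case using functional_equation[of r w] by auto
  qed simp
  obtain e where "\<forall>\<^sub>F m in sequentially.
      G (Suc r) (of_nat (Suc m) + z) = exp (newton_logG (Suc r) (Suc r) m z + e m)"
    using G_eq_exp_newton by blast
  then obtain m where "G (Suc r) (of_nat (Suc m) + z) = exp (newton_logG (Suc r) (Suc r) m z + e m)"
    unfolding eventually_sequentially by blast
  hence "G (Suc r) (of_nat (Suc m) + z) \<noteq> 0" by simp
  thus ?case using down[of z "Suc m"] Suc.prems by (simp only: add.commute[of z]) blast
qed

section \<open>The product formula\<close>

lemma G_shift:
  assumes "\<And>n. n \<ge> 1 \<Longrightarrow> z \<noteq> - of_nat n"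
  shows "G (Suc r) (of_nat (Suc N) + z) = (\<Prod>n=1..N. G r (z + of_nat n)) * G (Suc r) (z + 1)"
proof (induction N)
  case (Suc N)
  have nz: "G i (z + of_nat (Suc k)) \<noteq> 0" for i k
  proof (rule G_nonzero)
    fix n show "z + of_nat (Suc k) \<noteq> - of_nat n"
    proof
      assume "z + of_nat (Suc k) = - of_nat n"
      hence "(z + of_nat (Suc k)) - of_nat (Suc k) = - of_nat (Suc k + n)" by simp
      thus False using assms[of "Suc k + n"] by simp
    qed
  qed
  have "G (Suc r) ((z + of_nat (Suc N)) + 1) = G r (z + of_nat (Suc N)) * G (Suc r) (z + of_nat (Suc N))"
    using nz[of "Suc r" "Suc N"] nz[of r N] by (intro functional_equation) (auto simp: add_ac)
  thus ?case using Suc by (simp add: add_ac mult_ac)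
qed (simp add: add_ac)

text \<open>
  The differences of \<open>log G\<^sub>r\<close> are the \<open>log G\<^sub>k\<close> with \<open>k \<le> r\<close>; this turns the interpolation polynomial into
  the logarithm of the correcting product, together with \<open>log G\<^sub>r(m + 1)\<close> as the term for \<open>k = r\<close>.
\<close>

lemma newton_logG_eq:
  "newton_logG r r m z = (\<Sum>k=0..r. (z gchoose (r - k)) * of_real (logG k (real m)))"
proof -
  have "newton_logG r r m z = (\<Sum>k=0..r. (z gchoose k) * of_real (logG (r - k) (real m)))"
    unfolding newton_sum_def atLeast0AtMost fwd_diff_pow_of_real
  proof (intro sum.cong refl)
    fix k assume "k \<in> {..r}"
    thus "(z gchoose k) * of_real ((fwd_diff ^^ k) (\<lambda>i. logG r (real i)) m)
        = (z gchoose k) * of_real (logG (r - k) (real m))"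
      using fwd_diff_logG[of k "r - k"] by simp
  qed
  also have "\<dots> = (\<Sum>k=0..r. (z gchoose (r - k)) * of_real (logG k (real m)))"
    by (subst sum.atLeastAtMost_rev) simp
  finally show ?thesis .
qed

lemma G_of_nat: "G k (of_nat (Suc m)) = of_real (exp (logG k (real m)))"
  using G_eq_exp_logG[of "real m" k] by (simp add: add_ac)

lemma G_powr: "G k (of_nat (Suc m)) powr w = exp (w * of_real (logG k (real m)))"
  unfolding G_of_nat by (simp add: powr_def Ln_of_real)

text \<open>
  The principal powers are multiplicative here because all bases are positive reals.
\<close>

lemma G_ratio_powr_telescope:
  "(\<Prod>n=1..N. (G k (of_nat (n + 1)) / G k (of_nat n)) powr w) = G k (of_nat (N + 1)) powr w"
proof (induction N)
  case (Suc N)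
  have "G k (of_nat (Suc (Suc N))) / G k (of_nat (Suc N))
      = of_real (exp (logG k (real (Suc N)) - logG k (real N)))"
    unfolding G_of_nat by (simp add: exp_diff)
  hence "(G k (of_nat (Suc (Suc N))) / G k (of_nat (Suc N))) powr w
      = exp (w * of_real (logG k (real (Suc N)) - logG k (real N)))"
    by (simp only: powr_def) (simp add: Ln_of_real)
  thus ?case using Suc
    by (simp add: G_powr exp_add[symmetric] algebra_simps del: of_nat_Suc)
qed (simp add: G_at_1)

text \<open>
  By the functional equation the product over \<open>n\<close> equals
  \<open>G\<^bsub>r+1\<^esub>(N + 1) G\<^bsub>r+1\<^esub>(z + 1) / G\<^bsub>r+1\<^esub>(N + 1 + z)\<close>, and the expansion of \<open>G\<^bsub>r+1\<^esub>(N + 1 + z)\<close> cancels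
  everything but \<open>G\<^bsub>r+1\<^esub>(z + 1)\<close> and the exponential of an error that tends to \<open>0\<close>.
\<close>

theorem G_product_limit:
  assumes z: "\<And>n. n \<ge> 1 \<Longrightarrow> z \<noteq> - of_nat n"
  shows "(\<lambda>N. (\<Prod>n=1..N. G r (of_nat n) / G r (z + of_nat n)) *
             (\<Prod>k=0..r. G k (of_nat (N + 1)) powr (z gchoose (Suc r - k))))
           \<longlonglongrightarrow> G (Suc r) (z + 1)"
proof -
  obtain e where e: "e \<longlonglongrightarrow> 0" "\<forall>\<^sub>F N in sequentially.
      G (Suc r) (of_nat (Suc N) + z) = exp (newton_logG (Suc r) (Suc r) N z + e N)"
    using G_eq_exp_newton by blast
  have "(\<lambda>N. G (Suc r) (z + 1) * exp (- e N)) \<longlonglongrightarrow> G (Suc r) (z + 1) * exp (- 0)"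
    using e(1) by (intro tendsto_intros)
  hence lim: "(\<lambda>N. G (Suc r) (z + 1) * exp (- e N)) \<longlonglongrightarrow> G (Suc r) (z + 1)" by simp
  show ?thesis
  proof (rule Lim_transform_eventually[OF lim], use e(2) in eventually_elim)
    case (elim N)
    define S where "S = (\<Sum>k=0..r. (z gchoose (Suc r - k)) * complex_of_real (logG k (real N)))"
    define L where "L = complex_of_real (logG (Suc r) (real N))"
    have num: "(\<Prod>n=1..N. G r (of_nat n)) = exp L"
      using G_shift[of 0 r N] by (simp add: L_def G_of_nat exp_of_real G_at_1 del: of_nat_Suc)
    have "(\<Prod>n=1..N. G r (z + of_nat n)) * G (Suc r) (z + 1) = exp (S + L + e N)"
      using G_shift[OF z, where r=r and N=N] elim unfolding newton_logG_eq by (simp add: S_def L_def)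
    moreover from this have "G (Suc r) (z + 1) \<noteq> 0" by auto
    ultimately have den: "(\<Prod>n=1..N. G r (z + of_nat n)) = exp (S + L + e N) / G (Suc r) (z + 1)"
      by (simp add: field_simps)
    have "(\<Prod>k=0..r. G k (of_nat (N + 1)) powr (z gchoose (Suc r - k))) = exp S"
      unfolding S_def by (simp add: exp_sum G_powr del: of_nat_Suc)
    thus ?case unfolding prod_dividef num den
      by (simp add: exp_add exp_minus field_simps)
  qed
qed

end

text \<open>
  The factors that distinguish the two formulas telescope, so their partial products are equal.
\<close>

theorem theorem1p1:
  fixes G :: "nat \<Rightarrow> complex \<Rightarrow> complex" and r :: nat and z :: complex
  assumes "vigneras_multiple_gamma G"
    and "r \<ge> 1"
    and "\<forall>n::nat. n \<ge> 1 \<longrightarrow> z \<noteq> - of_nat n"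
  shows "((\<lambda>N::nat. (\<Prod>n=1..N. G (r - 1) (of_nat n) / G (r - 1) (z + of_nat n)) *
             (\<Prod>k=0..r-1. G k (of_nat (N + 1)) powr (z gchoose (r - k))))
           \<longlonglongrightarrow> G r (z + 1)) \<and>
         ((\<lambda>N::nat. \<Prod>n=1..N. G (r - 1) (of_nat n) / G (r - 1) (z + of_nat n) *
             (\<Prod>k=0..r-1. (G k (of_nat (n + 1)) / G k (of_nat n)) powr (z gchoose (r - k))))
           \<longlonglongrightarrow> G r (z + 1))"
proof -
  interpret multiple_gamma G by unfold_locales fact
  obtain s where r: "r = Suc s" using \<open>r \<ge> 1\<close> by (cases r) auto
  have lim: "(\<lambda>N. (\<Prod>n=1..N. G s (of_nat n) / G s (z + of_nat n)) *
             (\<Prod>k=0..s. G k (of_nat (N + 1)) powr (z gchoose (Suc s - k))))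
           \<longlonglongrightarrow> G (Suc s) (z + 1)"
    using assms(3) by (intro G_product_limit) auto
  have "(\<Prod>n=1..N. \<Prod>k=0..s. (G k (of_nat (n + 1)) / G k (of_nat n)) powr (z gchoose (Suc s - k)))
      = (\<Prod>k=0..s. G k (of_nat (N + 1)) powr (z gchoose (Suc s - k)))" for N
    by (subst prod.swap) (simp only: G_ratio_powr_telescope)
  thus ?thesis using lim unfolding r diff_Suc_1 prod.distrib by simp
qed

end
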